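(* Let $V$ be a closed isometric operator in a Hilbert space $H$. Let $\zeta\in\mathbb{T}$, and let $\zeta^{-1}$ be a point of the regular type of $V$. Then the following decompositions are valid: $$D(V)\dotplus N_\zeta=H;\qquad R(V)\dotplus N_\zeta=H.$$
   Context: All Hilbert spaces are complex and separable. $\mathbb{T}=\{z\in\mathbb{C}:|z|=1\}$. A closed isometric operator $V$ in $H$ is a linear isometry defined on a closed subspace $D(V)\subseteq H$ with range $R(V)\subseteq H$. $E_H$ is the identity on $H$. Set $M_\zeta=(E_H-\zeta V)D(V)$ and $N_\zeta=H\ominus M_\zeta$ (the orthogonal complement of $M_\zeta$ in $H$). A point $\lambda\in\mathbb{C}$ is a point of the regular type of $V$ if $V-\lambda E_H$ has a bounded inverse defined on its range $(V-\lambda E_H)D(V)$, i.e. there is $c>0$ with $\|(V-\lambda E_H)f\|\ge c\|f\|$ for all $f\in D(V)$. The symbol $\dotplus$ denotes the direct (not necessarily orthogonal) sum: the summands have trivial intersection. *)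

theory Defs
  imports "HOL-Analysis.Analysis"
begin

text \<open>
  A complex inner product space is presented as a real one whose real scalars and real inner
  product are those induced by the complex structure (\<open>Re_cinner\<close>), so that the norm and the
  topology are the library ones and \<open>\<parallel>x\<parallel>\<^sup>2 = (x, x)\<close> (\<open>cinner_self\<close> below).
  The product is linear in its first argument.
\<close>

class complex_inner = real_inner +
  fixes scaleC :: "complex \<Rightarrow> 'a \<Rightarrow> 'a"  (infixr \<open>*\<^sub>C\<close> 75)
    and cinner :: "'a \<Rightarrow> 'a \<Rightarrow> complex"
  assumes scaleC_add_right: "a *\<^sub>C (x + y) = a *\<^sub>C x + a *\<^sub>C y"
    and scaleC_add_left: "(a + b) *\<^sub>C x = a *\<^sub>C x + b *\<^sub>C x"
    and scaleC_scaleC: "a *\<^sub>C b *\<^sub>C x = (a * b) *\<^sub>C x"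
    and scaleC_of_real: "complex_of_real r *\<^sub>C x = r *\<^sub>R x"
    and cinner_commute: "cinner x y = cnj (cinner y x)"
    and cinner_add_left: "cinner (x + y) z = cinner x z + cinner y z"
    and cinner_scaleC_left: "cinner (a *\<^sub>C x) y = a * cinner x y"
    and Re_cinner: "Re (cinner x y) = inner x y"

class complex_hilbert = complex_inner + complete_space

global_interpretation complex_vector: vector_space "scaleC :: complex \<Rightarrow> 'a \<Rightarrow> 'a::complex_inner"
  defines csubspace = complex_vector.subspace
  by unfold_locales
    (simp_all add: scaleC_add_right scaleC_add_left scaleC_scaleC scaleC_of_real[of 1, simplified])

lemma cinner_self: "cinner x x = complex_of_real ((norm x)\<^sup>2)"
proof -
  have "Im (cinner x x) = 0"
    using arg_cong[OF cinner_commute[of x x], of Im] by simp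
  then show ?thesis
    by (simp add: complex_eq_iff Re_cinner power2_norm_eq_inner)
qed

instantiation complex :: complex_hilbert
begin

definition scaleC_complex :: "complex \<Rightarrow> complex \<Rightarrow> complex" where
  "scaleC_complex a x = a * x"

definition cinner_complex :: "complex \<Rightarrow> complex \<Rightarrow> complex" where
  "cinner_complex x y = x * cnj y"

instance
  by standard
    (simp_all add: scaleC_complex_def cinner_complex_def algebra_simps scaleR_conv_of_real
      inner_complex_def)

end

definition corthogonal_complement :: "'a::complex_inner set \<Rightarrow> 'a set" where
  "corthogonal_complement M = {h. \<forall>m\<in>M. cinner h m = 0}"

text \<open>
  An operator in \<open>H\<close> is given by its domain \<open>D\<close> together with a total function \<open>V\<close>, of which
  only the values on \<open>D\<close> are relevant. Its range is \<open>V ` D\<close>.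
\<close>

definition closed_isometric_operator :: "'a::complex_inner set \<Rightarrow> ('a \<Rightarrow> 'a) \<Rightarrow> bool" where
  "closed_isometric_operator D V \<longleftrightarrow>
     csubspace D \<and> closed D \<and>
     (\<forall>x\<in>D. \<forall>y\<in>D. V (x + y) = V x + V y) \<and>
     (\<forall>a. \<forall>x\<in>D. V (a *\<^sub>C x) = a *\<^sub>C V x) \<and>
     (\<forall>x\<in>D. norm (V x) = norm x)"

definition regular_type_point :: "'a::complex_inner set \<Rightarrow> ('a \<Rightarrow> 'a) \<Rightarrow> complex \<Rightarrow> bool" where
  "regular_type_point D V z \<longleftrightarrow> (\<exists>c>0. \<forall>f\<in>D. norm (V f - z *\<^sub>C f) \<ge> c * norm f)"

definition M_space :: "'a::complex_inner set \<Rightarrow> ('a \<Rightarrow> 'a) \<Rightarrow> complex \<Rightarrow> 'a set" where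
  "M_space D V \<zeta> = (\<lambda>f. f - \<zeta> *\<^sub>C V f) ` D"

definition N_space :: "'a::complex_inner set \<Rightarrow> ('a \<Rightarrow> 'a) \<Rightarrow> complex \<Rightarrow> 'a set" where
  "N_space D V \<zeta> = corthogonal_complement (M_space D V \<zeta>)"

definition is_direct_sum :: "'a::complex_inner set \<Rightarrow> 'a set \<Rightarrow> 'a set \<Rightarrow> bool" where
  "is_direct_sum A B W \<longleftrightarrow>
     csubspace A \<and> csubspace B \<and> A \<inter> B = {0} \<and> {a + b |a b. a \<in> A \<and> b \<in> B} = W"

end

theory Submission
  imports Defs
begin

text \<open>
  Put \<open>W = \<zeta> V\<close>, an isometry on \<open>D\<close>, and \<open>A = E - W\<close>, so that \<open>M = A D\<close>. Since \<open>\<parallel>W f\<parallel> = \<parallel>f\<parallel>\<close>,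
  expanding \<open>\<parallel>f - W f\<parallel>\<^sup>2\<close> gives \<open>Re (f, A f) = \<parallel>A f\<parallel>\<^sup>2 / 2 = - Re (W f, A f)\<close>,
  and as \<open>\<zeta>\<inverse>\<close> is of regular type, \<open>\<parallel>A f\<parallel> \<ge> c \<parallel>f\<parallel>\<close>. Thus the two forms \<open>(f, A h)\<close> and \<open>(W f, A h)\<close>
  on \<open>D\<close> are coercive up to sign (\<open>isometry_coercive\<close>).

  Coercivity yields both halves of each decomposition. If \<open>f\<close> (or \<open>W f\<close>) is orthogonal to \<open>M\<close>, then
  it is orthogonal to \<open>A f\<close>, whence \<open>f = 0\<close>. Conversely, an argument of Lax--Milgram type
  (\<open>coercive_pair_solvable\<close>) finds for every \<open>x\<close> an \<open>f\<close> in \<open>D\<close> such that \<open>x - f\<close> (or \<open>x - W f\<close>)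
  is orthogonal to \<open>M\<close>. This works with the real inner product: \<open>M\<close> is invariant
  under multiplication by \<open>\<i>\<close>, so real orthogonality to \<open>M\<close> is complex orthogonality
  (\<open>N_space_iff_inner\<close>). Finally \<open>W\<close> and \<open>V\<close> have the same range.
\<close>

section \<open>Orthogonal projection onto a complete subspace\<close>

text \<open>
  The parallelogram law, read at the midpoint of \<open>s\<close> and \<open>t\<close>: two near-minimisers of the distance
  to \<open>x\<close> lie close to each other. This makes minimising sequences Cauchy.
\<close>

lemma near_minimisers_close:
  fixes x s t :: "'a::real_inner"
  assumes "subspace S" "s \<in> S" "t \<in> S"
    and lower: "\<And>u. u \<in> S \<Longrightarrow> d \<le> (norm (x - u))\<^sup>2"
    and "(norm (x - s))\<^sup>2 \<le> d + e" "(norm (x - t))\<^sup>2 \<le> d + e"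
  shows "(norm (s - t))\<^sup>2 \<le> 4 * e"
proof -
  have "(1/2) *\<^sub>R (s + t) \<in> S"
    using assms by (simp add: subspace_add subspace_scale)
  then have "d \<le> (norm (x - (1/2) *\<^sub>R (s + t)))\<^sup>2"
    by (rule lower)
  moreover have "(norm (s - t))\<^sup>2 = 2 * (norm (x - s))\<^sup>2 + 2 * (norm (x - t))\<^sup>2
      - 4 * (norm (x - (1/2) *\<^sub>R (s + t)))\<^sup>2"
    unfolding power2_norm_eq_inner
    by (simp add: inner_diff_left inner_diff_right inner_add_left inner_add_right
        inner_commute field_simps)
  ultimately show ?thesis
    using assms by linarith
qed

text \<open>
  Moving from a nearest point \<open>p\<close> along a direction \<open>s\<close> of the subspace cannot decrease the distance
  to \<open>x\<close>; to first order this says that \<open>x - p\<close> is orthogonal to \<open>s\<close>.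
\<close>

lemma nearest_point_orthogonal:
  fixes x p :: "'a::real_inner"
  assumes S: "subspace S" "p \<in> S" "s \<in> S"
    and nearest: "\<And>u. u \<in> S \<Longrightarrow> norm (x - p) \<le> norm (x - u)"
  shows "inner (x - p) s = 0"
proof (cases "s = 0")
  case False
  define a where "a = inner (x - p) s"
  \<comment> \<open>the coefficient of the projection of \<open>x - p\<close> onto the line through \<open>s\<close>\<close>
  define t where "t = a / inner s s"
  have "p + t *\<^sub>R s \<in> S"
    using S by (simp add: subspace_add subspace_scale)
  then have "(norm (x - p))\<^sup>2 \<le> (norm (x - (p + t *\<^sub>R s)))\<^sup>2"
    by (intro power_mono nearest) auto
  also have "\<dots> = (norm ((x - p) - t *\<^sub>R s))\<^sup>2"
    by (simp add: algebra_simps)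
  also have "\<dots> = (norm (x - p))\<^sup>2 - 2 * t * a + t * t * inner s s"
    unfolding power2_norm_eq_inner a_def
    by (simp add: inner_diff_left[of "x - p"] inner_diff_right[of _ "x - p"] inner_commute
        algebra_simps)
  also have "\<dots> = (norm (x - p))\<^sup>2 - a\<^sup>2 / inner s s"
    using False by (simp add: t_def field_simps power2_eq_square)
  finally have "a\<^sup>2 / inner s s \<le> 0"
    by simp
  moreover have "inner s s > 0"
    using False by simp
  ultimately have "a\<^sup>2 \<le> 0"
    by (simp add: divide_le_0_iff)
  then show ?thesis
    by (simp add: a_def)
qed simp

lemma orthogonal_projection_exists:
  fixes x :: "'a::real_inner"
  assumes S: "subspace S" and "complete S"
  shows "\<exists>p\<in>S. \<forall>s\<in>S. inner (x - p) s = 0"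
proof -
  define d where "d = (INF u\<in>S. (norm (x - u))\<^sup>2)"
  have ne: "S \<noteq> {}"
    using subspace_0[OF S] by blast
  have bdd: "bdd_below ((\<lambda>u. (norm (x - u))\<^sup>2) ` S)"
    by (rule bdd_belowI2[of _ 0]) simp
  have lower: "d \<le> (norm (x - u))\<^sup>2" if "u \<in> S" for u
    unfolding d_def using bdd that by (rule cINF_lower)
  have "\<exists>u\<in>S. (norm (x - u))\<^sup>2 < d + inverse (real (Suc n))" for n
    using cINF_less_iff[OF ne bdd, of "d + inverse (real (Suc n))"] by (simp add: d_def)
  then obtain s where s: "\<And>n. s n \<in> S"
    and near: "\<And>n. (norm (x - s n))\<^sup>2 < d + inverse (real (Suc n))"
    by metis
  have "Cauchy s"
  proof (rule CauchyI)
    fix e :: real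
    assume "0 < e"
    then obtain N where N: "inverse (real (Suc N)) < e\<^sup>2 / 4"
      using reals_Archimedean[of "e\<^sup>2 / 4"] by auto
    have "norm (s m - s n) < e" if "m \<ge> N" "n \<ge> N" for m n
    proof -
      have "inverse (real (Suc k)) \<le> inverse (real (Suc N))" if "k \<ge> N" for k
        using that by (intro le_imp_inverse_le) auto
      then have "(norm (x - s k))\<^sup>2 \<le> d + inverse (real (Suc N))" if "k \<ge> N" for k
        using near[of k] that by (meson add_left_mono less_imp_le order_trans)
      then have "(norm (s m - s n))\<^sup>2 \<le> 4 * inverse (real (Suc N))"
        by (intro near_minimisers_close[OF S s s lower]) (use that in auto)
      also have "\<dots> < e\<^sup>2"
        using N by simp
      finally show ?thesis
        using \<open>0 < e\<close> by (simp add: power_less_imp_less_base)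
    qed
    then show "\<exists>M. \<forall>m\<ge>M. \<forall>n\<ge>M. norm (s m - s n) < e"
      by blast
  qed
  then obtain p where "p \<in> S" and lim: "s \<longlonglongrightarrow> p"
    using \<open>complete S\<close> s unfolding complete_def by blast
  have "(\<lambda>n. (norm (x - s n))\<^sup>2) \<longlonglongrightarrow> (norm (x - p))\<^sup>2"
    by (intro tendsto_intros lim)
  moreover have "(\<lambda>n. d + inverse (real (Suc n))) \<longlonglongrightarrow> d + 0"
    by (intro tendsto_add tendsto_const LIMSEQ_inverse_real_of_nat)
  ultimately have "(norm (x - p))\<^sup>2 \<le> d + 0"
    by (rule LIMSEQ_le) (use near less_imp_le in blast)
  then have "norm (x - p) \<le> norm (x - u)" if "u \<in> S" for u
    using lower[OF that] by (intro power2_le_imp_le[OF _ norm_ge_zero]) linarith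
  then show ?thesis
    using nearest_point_orthogonal[OF S \<open>p \<in> S\<close>] \<open>p \<in> S\<close> by blast
qed

section \<open>Pairs of operators with a coercive form\<close>

text \<open>
  As for the isometry itself, only the values on the domain \<open>D\<close> are constrained.
\<close>

definition bounded_linear_on :: "'a::real_normed_vector set \<Rightarrow> ('a \<Rightarrow> 'b::real_normed_vector) \<Rightarrow> bool"
  where "bounded_linear_on D A \<longleftrightarrow>
    (\<forall>x\<in>D. \<forall>y\<in>D. A (x + y) = A x + A y) \<and> (\<forall>r. \<forall>x\<in>D. A (r *\<^sub>R x) = r *\<^sub>R A x) \<and>
    (\<exists>K>0. \<forall>x\<in>D. norm (A x) \<le> K * norm x)"

lemma bounded_linear_on_diff:
  assumes "bounded_linear_on D A" "subspace D" "x \<in> D" "y \<in> D"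
  shows "A (x - y) = A x - A y"
proof -
  have "A (x + (-1) *\<^sub>R y) = A x + A ((-1) *\<^sub>R y)"
    using assms subspace_scale[of D y "-1"] unfolding bounded_linear_on_def by blast
  also have "A ((-1) *\<^sub>R y) = (-1) *\<^sub>R A y"
    using assms unfolding bounded_linear_on_def by blast
  finally show ?thesis
    by simp
qed

lemma bounded_linear_on_tendsto:
  assumes A: "bounded_linear_on D A" and D: "subspace D"
    and "\<And>n. s n \<in> D" "l \<in> D" "s \<longlonglongrightarrow> l"
  shows "(\<lambda>n. A (s n)) \<longlonglongrightarrow> A l"
proof -
  obtain K where K: "\<And>x. x \<in> D \<Longrightarrow> norm (A x) \<le> K * norm x"
    using A unfolding bounded_linear_on_def by blast
  have lim: "(\<lambda>n. K * norm (s n - l)) \<longlonglongrightarrow> 0"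
    using \<open>s \<longlonglongrightarrow> l\<close> by (intro tendsto_mult_right_zero tendsto_norm_zero) (simp add: LIM_zero)
  have bound: "norm (A (s n) - A l) \<le> K * norm (s n - l)" for n
    using K[of "s n - l"] bounded_linear_on_diff[OF A D] assms by (simp add: subspace_diff)
  have "(\<lambda>n. A (s n) - A l) \<longlonglongrightarrow> 0"
    by (rule Lim_null_comparison[OF always_eventually[OF allI, OF bound] lim])
  then show ?thesis
    by (rule LIM_zero_cancel)
qed

lemma subspace_bounded_linear_on_image:
  assumes "bounded_linear_on D A" "subspace D"
  shows "subspace (A ` D)"
proof (rule subspaceI)
  have "A (0 *\<^sub>R 0) = 0 *\<^sub>R A 0"
    using assms subspace_0[of D] unfolding bounded_linear_on_def by blast
  then show "0 \<in> A ` D"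
    using subspace_0[OF \<open>subspace D\<close>] by (auto simp: image_iff intro!: bexI[of _ 0])
next
  fix x y
  assume "x \<in> A ` D" "y \<in> A ` D"
  then obtain f g where "f \<in> D" "g \<in> D" "x = A f" "y = A g"
    by blast
  then have "x + y = A (f + g)" "f + g \<in> D"
    using assms by (auto simp: bounded_linear_on_def subspace_add)
  then show "x + y \<in> A ` D"
    by blast
next
  fix r x
  assume "x \<in> A ` D"
  then obtain f where "f \<in> D" "x = A f"
    by blast
  then have "r *\<^sub>R x = A (r *\<^sub>R f)" "r *\<^sub>R f \<in> D"
    using assms by (auto simp: bounded_linear_on_def subspace_scale)
  then show "r *\<^sub>R x \<in> A ` D"
    by blast
qed

text \<open>
  An a priori estimate \<open>\<parallel>f - g\<parallel> \<le> C \<parallel>x - y\<parallel>\<close> turns convergence of data into convergence of solutions.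
\<close>

lemma convergent_of_estimate:
  fixes x :: "nat \<Rightarrow> 'b::real_normed_vector" and f :: "nat \<Rightarrow> 'a::real_normed_vector"
  assumes "complete D" "\<And>n. f n \<in> D" "x \<longlonglongrightarrow> l"
    and est: "\<And>m n. norm (f m - f n) \<le> C * norm (x m - x n)"
  shows "\<exists>g\<in>D. f \<longlonglongrightarrow> g"
proof -
  have "Cauchy f"
  proof (rule CauchyI)
    fix e :: real
    assume "0 < e"
    define C' where "C' = \<bar>C\<bar> + 1"
    have "C' > 0" "C \<le> C'"
      by (auto simp: C'_def)
    have "Cauchy x"
      using \<open>x \<longlonglongrightarrow> l\<close> by (rule LIMSEQ_imp_Cauchy)
    then obtain M where M: "\<And>m n. m \<ge> M \<Longrightarrow> n \<ge> M \<Longrightarrow> norm (x m - x n) < e / C'"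
      using CauchyD[of x "e / C'"] \<open>0 < e\<close> \<open>C' > 0\<close> by auto
    have "norm (f m - f n) < e" if "m \<ge> M" "n \<ge> M" for m n
    proof -
      have "norm (f m - f n) \<le> C' * norm (x m - x n)"
        using est[of m n] mult_right_mono[OF \<open>C \<le> C'\<close>, of "norm (x m - x n)"] by simp
      also have "\<dots> < e"
        using M[OF that] \<open>C' > 0\<close> by (simp add: field_simps)
      finally show ?thesis .
    qed
    then show "\<exists>M. \<forall>m\<ge>M. \<forall>n\<ge>M. norm (f m - f n) < e"
      by blast
  qed
  then show ?thesis
    using assms unfolding complete_def by blast
qed

text \<open>
  A Lax--Milgram theorem for the form \<open>(f, h) \<mapsto> inner (B f) (A h)\<close>. Let \<open>U\<close> be the set of right-hand
  sides \<open>x\<close> for which the equation is solvable; it is the sum of \<open>B D\<close> and the orthogonal complement of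
  \<open>A D\<close>. Coercivity bounds \<open>\<parallel>f\<parallel>\<close> by a multiple of \<open>\<parallel>A f\<parallel>\<close> and, for a solution \<open>f\<close>, by a multiple of \<open>\<parallel>x\<parallel>\<close>;
  hence \<open>A D\<close> and \<open>U\<close> are closed. A vector orthogonal to \<open>U\<close> is orthogonal to the complement of \<open>A D\<close>,
  so, \<open>A D\<close> being closed, it equals \<open>A g\<close> for some \<open>g\<close>, and being orthogonal to \<open>B g\<close> it vanishes by coercivity.
\<close>

lemma coercive_pair_solvable:
  fixes A B :: "'b::real_normed_vector \<Rightarrow> 'a::{real_inner,complete_space}"
  assumes D: "subspace D" "complete D"
    and A: "bounded_linear_on D A" and B: "bounded_linear_on D B"
    and "\<kappa> > 0" and coercive: "\<And>f. f \<in> D \<Longrightarrow> \<kappa> * (norm f)\<^sup>2 \<le> \<bar>inner (B f) (A f)\<bar>"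
  shows "\<exists>f\<in>D. \<forall>h\<in>D. inner (x - B f) (A h) = 0"
proof -
  obtain K where "K > 0" and K: "\<And>f. f \<in> D \<Longrightarrow> norm (A f) \<le> K * norm f"
    using A unfolding bounded_linear_on_def by blast
  obtain L where "L > 0" and L: "\<And>f. f \<in> D \<Longrightarrow> norm (B f) \<le> L * norm f"
    using B unfolding bounded_linear_on_def by blast
  have cancel: "norm f \<le> (C / \<kappa>) * r"
    if "\<kappa> * (norm f)\<^sup>2 \<le> C * norm f * r" "C > 0" "r \<ge> 0" for f :: 'b and C r :: real
  proof (cases "f = 0")
    case False
    then have "\<kappa> * norm f \<le> C * r"
      using that(1) mult_le_cancel_right_pos[of "norm f" "\<kappa> * norm f" "C * r"]
      by (simp add: power2_eq_square mult_ac)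
    then show ?thesis
      using \<open>\<kappa> > 0\<close> by (simp add: field_simps)
  qed (use that \<open>\<kappa> > 0\<close> in simp)
  have A_below: "norm f \<le> (L / \<kappa>) * norm (A f)" if "f \<in> D" for f
  proof (rule cancel)
    have "\<kappa> * (norm f)\<^sup>2 \<le> norm (B f) * norm (A f)"
      using coercive[OF that] Cauchy_Schwarz_ineq2[of "B f" "A f"] by linarith
    also have "\<dots> \<le> L * norm f * norm (A f)"
      using L[OF that] by (simp add: mult_right_mono)
    finally show "\<kappa> * (norm f)\<^sup>2 \<le> L * norm f * norm (A f)" .
  qed (use \<open>L > 0\<close> in auto)
  have closed_AD: "closed (A ` D)"
    unfolding closed_sequential_limits
  proof (intro allI impI)
    fix y l
    assume *: "(\<forall>n. y n \<in> A ` D) \<and> y \<longlonglongrightarrow> l"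
    then obtain f where f: "\<And>n. f n \<in> D" "\<And>n. y n = A (f n)"
      unfolding image_iff by metis
    have est: "norm (f m - f n) \<le> (L / \<kappa>) * norm (y m - y n)" for m n
      using A_below[of "f m - f n"] f bounded_linear_on_diff[OF A D(1)] D(1)
      by (simp add: subspace_diff)
    obtain g where "g \<in> D" "f \<longlonglongrightarrow> g"
      using convergent_of_estimate[OF D(2) f(1) conjunct2[OF *] est] by blast
    have "y = (\<lambda>n. A (f n))"
      using f(2) by blast
    then have "y \<longlonglongrightarrow> A g"
      using bounded_linear_on_tendsto[OF A D(1) f(1) \<open>g \<in> D\<close> \<open>f \<longlonglongrightarrow> g\<close>]
      by simp
    then show "l \<in> A ` D"
      using * LIMSEQ_unique \<open>g \<in> D\<close> by blast
  qed
  define U where "U = {x. \<exists>f\<in>D. \<forall>h\<in>D. inner (x - B f) (A h) = 0}"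
  have U: "subspace U"
  proof (rule subspaceI)
    have "B (0 - 0) = B 0 - B 0"
      using B D(1) subspace_0[OF D(1)] by (intro bounded_linear_on_diff) auto
    then show "0 \<in> U"
      unfolding U_def using subspace_0[OF D(1)] by (auto intro!: bexI[of _ 0])
  next
    fix x y
    assume "x \<in> U" "y \<in> U"
    then obtain f g where "f \<in> D" "g \<in> D"
      and "\<And>h. h \<in> D \<Longrightarrow> inner (x - B f) (A h) = 0" "\<And>h. h \<in> D \<Longrightarrow> inner (y - B g) (A h) = 0"
      unfolding U_def by blast
    moreover from this have "B (f + g) = B f + B g"
      using B by (simp add: bounded_linear_on_def)
    ultimately show "x + y \<in> U"
      unfolding U_def using D(1)
      by (auto intro!: bexI[of _ "f + g"] simp: subspace_add inner_diff_left inner_add_left)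
  next
    fix r x
    assume "x \<in> U"
    then obtain f where "f \<in> D" and "\<And>h. h \<in> D \<Longrightarrow> inner (x - B f) (A h) = 0"
      unfolding U_def by blast
    moreover from this have "B (r *\<^sub>R f) = r *\<^sub>R B f"
      using B by (simp add: bounded_linear_on_def)
    ultimately show "r *\<^sub>R x \<in> U"
      unfolding U_def using D(1)
      by (auto intro!: bexI[of _ "r *\<^sub>R f"] simp: subspace_scale inner_diff_left)
  qed
  have "closed U"
    unfolding closed_sequential_limits
  proof (intro allI impI)
    fix y l
    assume *: "(\<forall>n. y n \<in> U) \<and> y \<longlonglongrightarrow> l"
    then obtain f where f: "\<And>n. f n \<in> D"
      and sol: "\<And>n h. h \<in> D \<Longrightarrow> inner (y n - B (f n)) (A h) = 0"
      unfolding U_def mem_Collect_eq by metis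
    have est: "norm (f m - f n) \<le> (K / \<kappa>) * norm (y m - y n)" for m n
    proof (rule cancel)
      let ?g = "f m - f n"
      have g: "?g \<in> D"
        using f D(1) by (simp add: subspace_diff)
      have "inner (B ?g) (A ?g) = inner (y m - y n) (A ?g)"
        using sol[OF g, of m] sol[OF g, of n] bounded_linear_on_diff[OF B D(1) f f, of m n]
        by (simp add: inner_diff_left)
      then have "\<kappa> * (norm ?g)\<^sup>2 \<le> norm (y m - y n) * norm (A ?g)"
        using coercive[OF g] Cauchy_Schwarz_ineq2[of "y m - y n" "A ?g"] by linarith
      also have "\<dots> \<le> norm (y m - y n) * (K * norm ?g)"
        using K[OF g] by (simp add: mult_left_mono)
      finally show "\<kappa> * (norm ?g)\<^sup>2 \<le> K * norm ?g * norm (y m - y n)"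
        by (simp add: mult_ac)
    qed (use \<open>K > 0\<close> in auto)
    obtain g where "g \<in> D" "f \<longlonglongrightarrow> g"
      using convergent_of_estimate[OF D(2) f conjunct2[OF *] est] by blast
    have "inner (l - B g) (A h) = 0" if "h \<in> D" for h
    proof -
      have "(\<lambda>n. inner (y n - B (f n)) (A h)) \<longlonglongrightarrow> inner (l - B g) (A h)"
        using * bounded_linear_on_tendsto[OF B D(1) f \<open>g \<in> D\<close> \<open>f \<longlonglongrightarrow> g\<close>]
        by (intro tendsto_intros) auto
      then show ?thesis
        using sol[OF that] by (simp add: LIMSEQ_const_iff)
    qed
    then show "l \<in> U"
      unfolding U_def using \<open>g \<in> D\<close> by blast
  qed
  then obtain u where "u \<in> U" and u: "\<And>s. s \<in> U \<Longrightarrow> inner (x - u) s = 0"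
    using orthogonal_projection_exists[OF U] by (meson complete_eq_closed)
  obtain m where "m \<in> A ` D" and m: "\<And>s. s \<in> A ` D \<Longrightarrow> inner ((x - u) - m) s = 0"
    using orthogonal_projection_exists[OF subspace_bounded_linear_on_image[OF A D(1)]] closed_AD
    by (meson complete_eq_closed)
  \<comment> \<open>The component \<open>q\<close> of \<open>x - u\<close> orthogonal to \<open>A D\<close> lies in \<open>U\<close>, where \<open>x - u\<close> has no component.\<close>
  let ?q = "(x - u) - m"
  have "B 0 = 0"
    using bounded_linear_on_diff[OF B D(1), of 0 0] subspace_0[OF D(1)] by simp
  then have "?q \<in> U"
    unfolding U_def using m subspace_0[OF D(1)] by (auto intro!: bexI[of _ 0])
  then have "inner (x - u) ?q = 0"
    by (rule u)
  moreover have "inner ?q m = 0"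
    using \<open>m \<in> A ` D\<close> by (rule m)
  ultimately have "inner ?q ?q = 0"
    by (simp add: inner_diff_right[of ?q "x - u" m] inner_commute)
  then have xu: "x - u = m"
    by simp
  obtain g where g: "g \<in> D" "m = A g"
    using \<open>m \<in> A ` D\<close> by blast
  have "B g \<in> U"
    unfolding U_def using g by (auto intro!: bexI[of _ g])
  then have "inner (B g) (A g) = 0"
    using u[of "B g"] g xu by (simp add: inner_commute)
  then have "g = 0"
    using coercive[OF g(1)] \<open>\<kappa> > 0\<close> by (simp add: mult_le_0_iff)
  then have "x - u = 0"
    using xu g K[OF g(1)] by simp
  then show ?thesis
    using \<open>u \<in> U\<close> by (simp add: U_def)
qed

section \<open>Complex subspaces and orthogonality\<close>

lemma csubspace_imp_subspace: "csubspace S \<Longrightarrow> subspace S"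
  unfolding complex_vector.subspace_def subspace_def by (simp flip: scaleC_of_real)

lemma norm_scaleC: "norm (a *\<^sub>C x) = cmod a * norm (x::'a::complex_inner)"
proof -
  have "complex_of_real ((norm (a *\<^sub>C x))\<^sup>2) = a * cnj (cinner (a *\<^sub>C x) x)"
    using cinner_scaleC_left[of a x "a *\<^sub>C x"] cinner_commute[of x "a *\<^sub>C x"]
      cinner_self[of "a *\<^sub>C x"] by simp
  also have "\<dots> = complex_of_real ((cmod a * norm x)\<^sup>2)"
    using complex_norm_square[of a]
    by (simp add: cinner_scaleC_left cinner_self power_mult_distrib)
  finally have "(norm (a *\<^sub>C x))\<^sup>2 = (cmod a * norm x)\<^sup>2"
    using of_real_eq_iff by blast
  then show ?thesis
    by (simp add: power2_eq_iff_nonneg)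
qed

lemma csubspace_corthogonal_complement: "csubspace (corthogonal_complement M)"
proof -
  have "cinner 0 m = 0" for m :: 'a
    using cinner_scaleC_left[of 0 0 m] complex_vector.scale_zero_left[of "0::'a"] by simp
  then show ?thesis
    unfolding complex_vector.subspace_def corthogonal_complement_def
    by (simp add: cinner_add_left cinner_scaleC_left)
qed

text \<open>
  The product is conjugate linear in its second argument, so \<open>Im (y, m) = Re (y, \<i> m)\<close>.
\<close>

lemma corthogonal_complement_iff_inner:
  assumes "\<And>m. m \<in> M \<Longrightarrow> \<i> *\<^sub>C m \<in> M"
  shows "y \<in> corthogonal_complement M \<longleftrightarrow> (\<forall>m\<in>M. inner y m = 0)"
proof -
  have "Im (cinner y m) = inner y (\<i> *\<^sub>C m)" for m
  proof -
    have "cinner y (\<i> *\<^sub>C m) = cnj (\<i> * cinner m y)"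
      using cinner_commute[of y "\<i> *\<^sub>C m"] cinner_scaleC_left[of \<i> m y] by simp
    also have "\<dots> = - \<i> * cinner y m"
      using cinner_commute[of y m] by simp
    finally show ?thesis
      using Re_cinner[of y "\<i> *\<^sub>C m"] by simp
  qed
  then show ?thesis
    using assms unfolding corthogonal_complement_def
    by (auto simp: complex_eq_iff Re_cinner)
qed

section \<open>Isometric operators and the decompositions\<close>

context
  fixes D :: "'a::complex_hilbert set" and V :: "'a \<Rightarrow> 'a" and \<zeta> :: complex
  assumes V: "closed_isometric_operator D V" and \<zeta>: "cmod \<zeta> = 1"
begin

lemma isometry_csubspace: "csubspace D"
  using V by (simp add: closed_isometric_operator_def)

lemma isometry_add: "x \<in> D \<Longrightarrow> y \<in> D \<Longrightarrow> V (x + y) = V x + V y"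
  using V by (simp add: closed_isometric_operator_def)

lemma isometry_scaleC: "x \<in> D \<Longrightarrow> V (a *\<^sub>C x) = a *\<^sub>C V x"
  using V by (simp add: closed_isometric_operator_def)

lemma isometry_norm: "x \<in> D \<Longrightarrow> norm (\<zeta> *\<^sub>C V x) = norm x"
  using V \<zeta> by (simp add: closed_isometric_operator_def norm_scaleC)

lemma isometry_csubspace_range: "csubspace (V ` D)"
proof -
  have "V 0 = 0"
    using V complex_vector.subspace_0[OF isometry_csubspace]
    by (metis closed_isometric_operator_def norm_eq_zero)
  then have "0 \<in> V ` D"
    using complex_vector.subspace_0[OF isometry_csubspace] by (metis image_eqI)
  moreover have "V x + V y \<in> V ` D" if "x \<in> D" "y \<in> D" for x y
    using that isometry_add complex_vector.subspace_add[OF isometry_csubspace]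
    by (metis image_eqI)
  moreover have "a *\<^sub>C V x \<in> V ` D" if "x \<in> D" for a x
    using that isometry_scaleC complex_vector.subspace_scale[OF isometry_csubspace]
    by (metis image_eqI)
  ultimately show ?thesis
    unfolding complex_vector.subspace_def by blast
qed

lemma isometry_bounded_linear_on: "bounded_linear_on D (\<lambda>f. \<zeta> *\<^sub>C V f)"
  unfolding bounded_linear_on_def
proof (intro conjI ballI allI exI[of _ 1])
  show "\<zeta> *\<^sub>C V (r *\<^sub>R x) = r *\<^sub>R \<zeta> *\<^sub>C V x" if "x \<in> D" for r x
    using isometry_scaleC[OF that, of "of_real r"]
    by (simp only: scaleC_of_real[symmetric] scaleC_scaleC mult.commute)
qed (auto simp: isometry_add isometry_norm scaleC_add_right)

lemma difference_bounded_linear_on: "bounded_linear_on D (\<lambda>f. f - \<zeta> *\<^sub>C V f)"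
proof -
  have "norm (f - \<zeta> *\<^sub>C V f) \<le> 2 * norm f" if "f \<in> D" for f
    using norm_triangle_ineq4[of f "\<zeta> *\<^sub>C V f"] isometry_norm[OF that] by simp
  then show ?thesis
    using isometry_bounded_linear_on unfolding bounded_linear_on_def
    by (auto simp: scaleR_diff_right intro!: exI[of _ 2])
qed

lemma N_space_iff_inner: "y \<in> N_space D V \<zeta> \<longleftrightarrow> (\<forall>h\<in>D. inner y (h - \<zeta> *\<^sub>C V h) = 0)"
proof -
  have "\<i> *\<^sub>C (h - \<zeta> *\<^sub>C V h) \<in> M_space D V \<zeta>" if "h \<in> D" for h
  proof -
    have "\<i> *\<^sub>C (h - \<zeta> *\<^sub>C V h) = \<i> *\<^sub>C h - \<zeta> *\<^sub>C V (\<i> *\<^sub>C h)"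
      using isometry_scaleC[OF that]
      by (simp add: complex_vector.scale_right_diff_distrib scaleC_scaleC mult.commute)
    then show ?thesis
      using that complex_vector.subspace_scale[OF isometry_csubspace]
      unfolding M_space_def by blast
  qed
  then show ?thesis
    unfolding N_space_def
    by (subst corthogonal_complement_iff_inner) (auto simp: M_space_def)
qed

text \<open>
  \<open>f\<close> and \<open>\<zeta> V f\<close> span an isosceles triangle, so the base \<open>f - \<zeta> V f\<close> makes equal angles with both legs.
  The regular type condition bounds its length from below.
\<close>

lemma isometry_coercive:
  assumes "regular_type_point D V (inverse \<zeta>)"
  obtains \<kappa> where "\<kappa> > 0"
    and "\<And>f. f \<in> D \<Longrightarrow> \<kappa> * (norm f)\<^sup>2 \<le> \<bar>inner f (f - \<zeta> *\<^sub>C V f)\<bar>"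
    and "\<And>f. f \<in> D \<Longrightarrow> \<kappa> * (norm f)\<^sup>2 \<le> \<bar>inner (\<zeta> *\<^sub>C V f) (f - \<zeta> *\<^sub>C V f)\<bar>"
proof -
  obtain c where "c > 0" and c: "\<And>f. f \<in> D \<Longrightarrow> c * norm f \<le> norm (V f - inverse \<zeta> *\<^sub>C f)"
    using assms unfolding regular_type_point_def by blast
  have "\<zeta> \<noteq> 0"
    using \<zeta> by auto
  have bounds: "c\<^sup>2 / 2 * (norm f)\<^sup>2 \<le> inner f (f - \<zeta> *\<^sub>C V f)"
      "c\<^sup>2 / 2 * (norm f)\<^sup>2 \<le> - inner (\<zeta> *\<^sub>C V f) (f - \<zeta> *\<^sub>C V f)" if "f \<in> D" for f
  proof -
    let ?w = "\<zeta> *\<^sub>C V f"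
    have "norm (V f - inverse \<zeta> *\<^sub>C f) = norm (\<zeta> *\<^sub>C (V f - inverse \<zeta> *\<^sub>C f))"
      by (simp add: norm_scaleC \<zeta>)
    also have "\<zeta> *\<^sub>C (V f - inverse \<zeta> *\<^sub>C f) = ?w - f"
      using \<open>\<zeta> \<noteq> 0\<close> by (simp add: complex_vector.scale_right_diff_distrib)
    finally have "c * norm f \<le> norm (f - ?w)"
      using c[OF that] by (simp add: norm_minus_commute)
    then have "(c * norm f)\<^sup>2 \<le> (norm (f - ?w))\<^sup>2"
      using \<open>c > 0\<close> by (intro power_mono) auto
    moreover have "inner ?w ?w = inner f f"
      using isometry_norm[OF that] by (simp flip: power2_norm_eq_inner)
    ultimately show "c\<^sup>2 / 2 * (norm f)\<^sup>2 \<le> inner f (f - ?w)"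
      "c\<^sup>2 / 2 * (norm f)\<^sup>2 \<le> - inner ?w (f - ?w)"
      using inner_commute[of f ?w]
      by (simp_all add: power_mult_distrib power2_norm_eq_inner inner_diff_left inner_diff_right)
  qed
  show ?thesis
  proof (rule that[of "c\<^sup>2 / 2"])
    show "c\<^sup>2 / 2 * (norm f)\<^sup>2 \<le> \<bar>inner f (f - \<zeta> *\<^sub>C V f)\<bar>" if "f \<in> D" for f
      using bounds(1)[OF that] by linarith
    show "c\<^sup>2 / 2 * (norm f)\<^sup>2 \<le> \<bar>inner (\<zeta> *\<^sub>C V f) (f - \<zeta> *\<^sub>C V f)\<bar>" if "f \<in> D" for f
      using bounds(2)[OF that] by linarith
  qed (use \<open>c > 0\<close> in simp)
qed

text \<open>
  The two decompositions are the instances \<open>B = E\<close> and \<open>B = \<zeta> V\<close>.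
\<close>

lemma direct_sum_of_coercive:
  assumes B: "bounded_linear_on D B" and "csubspace (B ` D)"
    and "\<kappa> > 0" and coercive: "\<And>f. f \<in> D \<Longrightarrow> \<kappa> * (norm f)\<^sup>2 \<le> \<bar>inner (B f) (f - \<zeta> *\<^sub>C V f)\<bar>"
  shows "is_direct_sum (B ` D) (N_space D V \<zeta>) UNIV"
proof -
  have D: "subspace D" "complete D"
    using V by (auto simp: closed_isometric_operator_def csubspace_imp_subspace complete_eq_closed)
  have N: "csubspace (N_space D V \<zeta>)"
    unfolding N_space_def by (rule csubspace_corthogonal_complement)
  have "B f = 0" if "f \<in> D" "B f \<in> N_space D V \<zeta>" for f
  proof -
    have "f = 0"
      using coercive[OF that(1)] that \<open>\<kappa> > 0\<close> by (simp add: N_space_iff_inner mult_le_0_iff)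
    then show ?thesis
      using bounded_linear_on_diff[OF B D(1) that(1) that(1)] by simp
  qed
  then have "B ` D \<inter> N_space D V \<zeta> = {0}"
    using complex_vector.subspace_0[OF N] complex_vector.subspace_0[OF \<open>csubspace (B ` D)\<close>]
    by blast
  moreover have "x \<in> {a + b |a b. a \<in> B ` D \<and> b \<in> N_space D V \<zeta>}" for x
  proof -
    obtain f where "f \<in> D" "x - B f \<in> N_space D V \<zeta>"
      using coercive_pair_solvable[OF D difference_bounded_linear_on B \<open>\<kappa> > 0\<close> coercive]
      unfolding N_space_iff_inner by blast
    moreover have "x = B f + (x - B f)"
      by simp
    ultimately show ?thesis
      by blast
  qed
  then have "{a + b |a b. a \<in> B ` D \<and> b \<in> N_space D V \<zeta>} = UNIV"
    by (rule UNIV_eq_I[symmetric])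
  ultimately show ?thesis
    unfolding is_direct_sum_def using N \<open>csubspace (B ` D)\<close> by (intro conjI)
qed

lemma range_unimodular_multiple: "(\<lambda>f. \<zeta> *\<^sub>C V f) ` D = V ` D"
proof (intro equalityI subsetI)
  fix y
  assume "y \<in> (\<lambda>f. \<zeta> *\<^sub>C V f) ` D"
  then show "y \<in> V ` D"
    using complex_vector.subspace_scale[OF isometry_csubspace_range] by blast
next
  fix y
  assume "y \<in> V ` D"
  then obtain f where "f \<in> D" "y = V f"
    by blast
  moreover have "\<zeta> \<noteq> 0"
    using \<zeta> by auto
  ultimately have "y = \<zeta> *\<^sub>C V (inverse \<zeta> *\<^sub>C f)" "inverse \<zeta> *\<^sub>C f \<in> D"
    using complex_vector.subspace_scale[OF isometry_csubspace] by (simp_all add: isometry_scaleC)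
  then show "y \<in> (\<lambda>f. \<zeta> *\<^sub>C V f) ` D"
    by blast
qed

end

theorem theorem4p1:
  fixes D :: "'a::complex_hilbert set" and V :: "'a \<Rightarrow> 'a" and \<zeta> :: complex
  assumes "separable_space (euclidean :: 'a topology)"
    and "closed_isometric_operator D V"
    and "cmod \<zeta> = 1"
    and "regular_type_point D V (inverse \<zeta>)"
  shows "is_direct_sum D (N_space D V \<zeta>) UNIV \<and> is_direct_sum (V ` D) (N_space D V \<zeta>) UNIV"
proof -
  note V = assms(2,3)
  obtain \<kappa> where "\<kappa> > 0"
    and id: "\<And>f. f \<in> D \<Longrightarrow> \<kappa> * (norm f)\<^sup>2 \<le> \<bar>inner f (f - \<zeta> *\<^sub>C V f)\<bar>"
    and W: "\<And>f. f \<in> D \<Longrightarrow> \<kappa> * (norm f)\<^sup>2 \<le> \<bar>inner (\<zeta> *\<^sub>C V f) (f - \<zeta> *\<^sub>C V f)\<bar>"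
    using isometry_coercive[OF V assms(4)] by blast
  have "bounded_linear_on D (\<lambda>f. f)"
    unfolding bounded_linear_on_def by (auto intro!: exI[of _ 1])
  then have "is_direct_sum ((\<lambda>f. f) ` D) (N_space D V \<zeta>) UNIV"
    using isometry_csubspace[OF V] by (intro direct_sum_of_coercive[OF V _ _ \<open>\<kappa> > 0\<close> id]) auto
  moreover have "is_direct_sum ((\<lambda>f. \<zeta> *\<^sub>C V f) ` D) (N_space D V \<zeta>) UNIV"
    using isometry_csubspace_range[OF V] range_unimodular_multiple[OF V]
    by (intro direct_sum_of_coercive[OF V isometry_bounded_linear_on[OF V] _ \<open>\<kappa> > 0\<close> W]) auto
  ultimately show ?thesis
    by (simp add: range_unimodular_multiple[OF V])
qed

end
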